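(* Let $u$ be a weight function on $(0,+\infty)$, and let $w$ be a measurable function on $(0,+\infty)$ with $w(x)\ge 0$ for each $x\in(0,+\infty)$ and such that $W(x)=\int_0^x w(s)\,\mathrm{d}s$ satisfies $0<W(x)<+\infty$ for all $x>0$. Assume that for each fixed $t\in(0,+\infty)$ the function $x\mapsto \frac{w(t)u(x)}{W(x)}$ is locally integrable on $(0,+\infty)$, and define $v$ by $$v(t)=w(t)\int_t^\infty \frac{u(x)}{W(x)}\,\mathrm{d}x<+\infty,\qquad t\in(0,+\infty),$$ (the finiteness being part of the assumption). Let $-\infty\le a<b\le+\infty$ and let $g:(a,b)\to\mathbb{R}$ be continuous and strictly monotone, and either convex decreasing or concave increasing. Then $$\int_0^\infty u(x)\,[\mathbf{M}^g_w f](x)\,\mathrm{d}x\le \int_0^\infty v(x) f(x)\,\mathrm{d}x$$ for all non-negative measurable functions $f$ on $(0,+\infty)$ such that $a<f(x)<b$ for all $x$ and $\mathbf{M}^g_w f$ is defined.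
   Context: A weight (function) on $(0,+\infty)$ is a positive measurable function. For a real continuous strictly monotone function $g$ with inverse $g^{-1}$, the generalized weighted mean operator is $$[\mathbf{M}^g_w f](x)=g^{-1}\left(\frac{1}{W(x)}\int_0^x w(t)\,g(f(t))\,\mathrm{d}t\right),\qquad W(x)=\int_0^x w(s)\,\mathrm{d}s,\quad x>0.$$ It is considered for those measurable $f$ with values in the domain of $g$ for which it is defined, i.e. $w\cdot(g\circ f)$ is integrable on $(0,x)$ for every $x>0$. Integrals of non-negative functions take values in $[0,+\infty]$. *)

theory Defs
  imports "HOL-Analysis.Analysis"
begin

text \<open>
  Functions on the half-line are total functions \<open>real \<Rightarrow> real\<close> of which only the values on
  \<open>{0<..}\<close> are used; measurability and integrals are with respect to Lebesgue measure.
\<close>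

definition weight_function :: "(real \<Rightarrow> real) \<Rightarrow> bool" where
  "weight_function u \<longleftrightarrow> u \<in> borel_measurable (lebesgue_on {0<..}) \<and> (\<forall>x>0. 0 < u x)"

definition locally_integrable_on :: "(real \<Rightarrow> real) \<Rightarrow> real set \<Rightarrow> bool"
    (infix "locally'_integrable'_on" 50) where
  "h locally_integrable_on S \<longleftrightarrow> (\<forall>K. compact K \<and> K \<subseteq> S \<longrightarrow> set_integrable lebesgue K h)"

text \<open>
  This Bochner integral is \<open>0\<close> by convention when \<open>w\<close> is not integrable on \<open>(0, x)\<close>, so
  \<open>W(x) < \<infinity>\<close> has to be stated as integrability.
\<close>

definition cumulative :: "(real \<Rightarrow> real) \<Rightarrow> real \<Rightarrow> real" where
  "cumulative w x = (LINT s:{0<..<x}|lebesgue. w s)"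

text \<open>
  \<open>D\<close> is the domain of \<open>g\<close>. When \<open>D\<close> is an interval, \<open>g\<close> is continuous and strictly monotone
  on it, \<open>w \<ge> 0\<close> with \<open>0 < W(x) < \<infinity>\<close>, \<open>f\<close> takes values in \<open>D\<close> and the mean is defined, the
  averages of \<open>g \<circ> f\<close> lie in \<open>g ` D\<close>, so that \<open>inv_into\<close> is applied only where it is the
  genuine inverse. If moreover \<open>f \<ge> 0\<close>, those averages lie in the image of \<open>D \<inter> {0..}\<close>, so that
  the mean is nonnegative and \<open>ennreal\<close> does not truncate it.
\<close>

definition gen_mean ::
    "real set \<Rightarrow> (real \<Rightarrow> real) \<Rightarrow> (real \<Rightarrow> real) \<Rightarrow> (real \<Rightarrow> real) \<Rightarrow> real \<Rightarrow> real" where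
  "gen_mean D g w f x =
     inv_into D g (1 / cumulative w x * (LINT t:{0<..<x}|lebesgue. w t * g (f t)))"

definition gen_mean_defined :: "(real \<Rightarrow> real) \<Rightarrow> (real \<Rightarrow> real) \<Rightarrow> (real \<Rightarrow> real) \<Rightarrow> bool" where
  "gen_mean_defined g w f \<longleftrightarrow> (\<forall>x>0. set_integrable lebesgue {0<..<x} (\<lambda>t. w t * g (f t)))"

end

theory Submission
  imports Defs
begin

text \<open>
  Replacing a concave increasing \<open>g\<close> by \<open>-g\<close>, assume that \<open>g\<close> is convex and decreasing. A supporting
  line of \<open>g\<close> at the mean \<open>m = [M f](x)\<close> has negative slope, so integrating it along \<open>f\<close> against \<open>w\<close>
  gives \<open>m W(x) \<le> \<integral> w f\<close> over \<open>(0, x)\<close>. Multiply by \<open>u(x) / W(x)\<close>, integrate in \<open>x\<close> and exchange the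
  order of integration.
\<close>

text \<open>Sets of \<open>M\<close> keep their measure in the completion, so the same countable
  cover works. This makes Tonelli available for \<open>lebesgue\<close>, the completion of
  \<open>lborel\<close>.\<close>

lemma sigma_finite_measure_completion:
  assumes "sigma_finite_measure M"
  shows "sigma_finite_measure (completion M)"
proof -
  obtain A where "countable A" "A \<subseteq> sets M" "\<Union>A = space M" "\<And>a. a \<in> A \<Longrightarrow> emeasure M a \<noteq> \<infinity>"
    using sigma_finite_measure.sigma_finite_countable[OF assms] by blast
  then show ?thesis
    by (intro sigma_finite_measure.intro exI[of _ A])
       (auto simp: subset_iff emeasure_completion)
qed

text \<open>Tonelli: both sides integrate \<open>A x * B t\<close> over the region
  \<open>t < x\<close>.\<close>

lemma nn_integral_triangle_swap:
  fixes A B :: "real \<Rightarrow> ennreal"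
  assumes [measurable]: "A \<in> borel_measurable lebesgue" "B \<in> borel_measurable lebesgue"
  shows "(\<integral>\<^sup>+x. A x * (\<integral>\<^sup>+t\<in>{..<x}. B t \<partial>lebesgue) \<partial>lebesgue) =
    (\<integral>\<^sup>+t. B t * (\<integral>\<^sup>+x\<in>{t<..}. A x \<partial>lebesgue) \<partial>lebesgue)"
proof -
  have "sigma_finite_measure (lebesgue :: real measure)"
    by (rule sigma_finite_measure_completion) (rule lborel.sigma_finite_measure_axioms)
  then interpret pair_sigma_finite "lebesgue :: real measure" "lebesgue :: real measure"
    by (simp add: pair_sigma_finite_def)
  \<comment> \<open>Makes both coordinates Borel measurable on the product of the two copies of
    \<open>lebesgue\<close>, and hence the condition \<open>t < x\<close>.\<close>
  have [measurable]: "(\<lambda>x::real. x) \<in> lebesgue \<rightarrow>\<^sub>M borel"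
    by (simp add: id_borel_measurable_lebesgue[unfolded id_def])
  have "(\<integral>\<^sup>+x. A x * (\<integral>\<^sup>+t\<in>{..<x}. B t \<partial>lebesgue) \<partial>lebesgue) =
      (\<integral>\<^sup>+x. \<integral>\<^sup>+t. A x * (B t * (if t < x then 1 else 0)) \<partial>lebesgue \<partial>lebesgue)"
    by (subst nn_integral_cmult[symmetric]) (auto intro!: nn_integral_cong simp: indicator_def)
  also have "\<dots> = (\<integral>\<^sup>+t. \<integral>\<^sup>+x. A x * (B t * (if t < x then 1 else 0)) \<partial>lebesgue \<partial>lebesgue)"
    by (rule Fubini'[symmetric]) measurable
  also have "\<dots> = (\<integral>\<^sup>+t. B t * (\<integral>\<^sup>+x\<in>{t<..}. A x \<partial>lebesgue) \<partial>lebesgue)"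
    by (subst nn_integral_cmult[symmetric])
       (auto intro!: nn_integral_cong simp: indicator_def mult_ac)
  finally show ?thesis .
qed

text \<open>If the average \<open>c\<close> were outside \<open>S\<close>, all of \<open>S\<close>
  would lie strictly on one side of \<open>c\<close>. Then \<open>w * (q - c)\<close> has constant
  sign and integral zero, so it vanishes almost everywhere; since \<open>q\<close> never equals
  \<open>c\<close>, so does \<open>w\<close>, against its positive integral.\<close>

lemma weighted_average_in_interval:
  fixes w q :: "'a \<Rightarrow> real" and S :: "real set"
  assumes S: "is_interval S" and q: "\<And>t. t \<in> space M \<Longrightarrow> q t \<in> S"
    and w: "\<And>t. t \<in> space M \<Longrightarrow> 0 \<le> w t" "integrable M w" "0 < integral\<^sup>L M w"
    and wq: "integrable M (\<lambda>t. w t * q t)"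
  shows "integral\<^sup>L M (\<lambda>t. w t * q t) / integral\<^sup>L M w \<in> S"
proof (rule ccontr)
  define c where "c = integral\<^sup>L M (\<lambda>t. w t * q t) / integral\<^sup>L M w"
  assume "integral\<^sup>L M (\<lambda>t. w t * q t) / integral\<^sup>L M w \<notin> S"
  then have c: "c \<notin> S" by (simp add: c_def)
  have int: "integrable M (\<lambda>t. w t * (q t - c))"
    using w(2) wq by (simp add: right_diff_distrib)
  have zero: "integral\<^sup>L M (\<lambda>t. w t * (q t - c)) = 0"
    using w wq by (simp add: right_diff_distrib c_def)
  have "(\<forall>s\<in>S. s < c) \<or> (\<forall>s\<in>S. c < s)"
    using S c unfolding is_interval_1 by (meson linorder_not_less nle_le)
  then have "AE t in M. w t * (q t - c) = 0"
  proof
    assume "\<forall>s\<in>S. c < s"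
    then have "AE t in M. 0 \<le> w t * (q t - c)"
      using q w(1) by (intro AE_I2 mult_nonneg_nonneg) (auto intro: less_imp_le)
    then show ?thesis
      using integral_nonneg_eq_0_iff_AE[OF int] zero by simp
  next
    assume lt: "\<forall>s\<in>S. s < c"
    have "AE t in M. 0 \<le> - (w t * (q t - c))"
      using lt q w(1) by (intro AE_I2) (auto simp: less_imp_le mult_nonneg_nonpos)
    then show ?thesis
      using integral_nonneg_eq_0_iff_AE[of M "\<lambda>t. - (w t * (q t - c))"] int zero by simp
  qed
  then have "AE t in M. w t = 0"
  proof (rule AE_mp, intro AE_I2 impI)
    fix t assume "t \<in> space M" "w t * (q t - c) = 0"
    then show "w t = 0" using q[of t] c by auto
  qed
  then have "integral\<^sup>L M w = 0"
    by (simp add: integral_eq_zero_AE)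
  with w(3) show False by simp
qed

text \<open>A form of Jensen's inequality. In the integrated supporting line the terms with
  \<open>h m\<close> cancel by the equation for \<open>m\<close>, and dividing by the negative slope
  reverses the inequality. If the right-hand side is infinite there is nothing to prove; otherwise
  \<open>w * f\<close> is integrable and the line can be integrated term by term.\<close>

lemma mean_le_nn_integral_of_convex_decreasing:
  fixes h :: "real \<Rightarrow> real" and f w :: "'a \<Rightarrow> real"
  assumes D: "open D" "m \<in> D" and h: "convex_on D h" "antimono_on D h" "inj_on h D"
    and f: "f \<in> borel_measurable M" "\<And>t. t \<in> space M \<Longrightarrow> f t \<in> D" "\<And>t. t \<in> space M \<Longrightarrow> 0 \<le> f t"
    and w: "integrable M w" "\<And>t. t \<in> space M \<Longrightarrow> 0 \<le> w t"
    and wh: "integrable M (\<lambda>t. w t * h (f t))"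
    and m: "h m * integral\<^sup>L M w = integral\<^sup>L M (\<lambda>t. w t * h (f t))"
  shows "ennreal (m * integral\<^sup>L M w) \<le> (\<integral>\<^sup>+t. ennreal (w t * f t) \<partial>M)"
proof (cases "(\<integral>\<^sup>+t. ennreal (w t * f t) \<partial>M) = \<infinity>")
  case False
  \<comment> \<open>\<open>c\<close> is the slope of a supporting line at \<open>m\<close>, which
    exists because \<open>m\<close> is interior to the open set \<open>D\<close>.\<close>
  obtain c where c: "\<And>y. y \<in> D \<Longrightarrow> h m + c * (y - m) \<le> h y"
    using convex_le_Inf_differential[OF h(1)] D by (metis interior_open)
  obtain e where e: "e > 0" "\<And>y. \<bar>y - m\<bar> < e \<Longrightarrow> y \<in> D"
    using D by (metis dist_real_def open_dist)
  \<comment> \<open>At a point of \<open>D\<close> to the right of \<open>m\<close> the function is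
    strictly below \<open>h m\<close>, being antitone and injective. The supporting line therefore
    descends, which excludes slope zero.\<close>
  define y where "y = m + e / 2"
  have y: "y \<in> D" "m < y" using e by (auto simp: y_def)
  then have "h y < h m"
    using h(2,3) D(2) by (metis inj_onD less_eq_real_def monotone_onD order_less_irrefl)
  with c[OF y(1)] have "c * (y - m) < 0" by linarith
  then have c_neg: "c < 0" using y(2) by (simp add: mult_less_0_iff)
  have nonneg: "AE t in M. 0 \<le> w t * f t" using w(2) f(3) by auto
  have wf: "integrable M (\<lambda>t. w t * f t)"
    using False nonneg f(1) borel_measurable_integrable[OF w(1)]
    by (intro integrableI_nonneg) (auto simp: less_top)
  have "integral\<^sup>L M (\<lambda>t. h m * w t + c * (w t * f t - m * w t)) \<le> integral\<^sup>L M (\<lambda>t. w t * h (f t))"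
  proof (rule integral_mono)
    fix t assume t: "t \<in> space M"
    have "w t * (h m + c * (f t - m)) \<le> w t * h (f t)"
      using c f(2) w(2) t by (intro mult_left_mono) auto
    then show "h m * w t + c * (w t * f t - m * w t) \<le> w t * h (f t)"
      by (simp add: algebra_simps)
  qed (use w wf wh in auto)
  also have "integral\<^sup>L M (\<lambda>t. h m * w t + c * (w t * f t - m * w t)) =
      h m * integral\<^sup>L M w + c * (integral\<^sup>L M (\<lambda>t. w t * f t) - m * integral\<^sup>L M w)"
    using w wf by simp
  finally have "c * (integral\<^sup>L M (\<lambda>t. w t * f t) - m * integral\<^sup>L M w) \<le> 0"
    using m by simp
  then have "m * integral\<^sup>L M w \<le> integral\<^sup>L M (\<lambda>t. w t * f t)"
    using c_neg by (simp add: mult_le_0_iff)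
  then show ?thesis
    using nn_integral_eq_integral[OF wf nonneg] by (simp add: ennreal_leI)
qed simp

text \<open>Applies the preceding lemma to \<open>g\<close> or \<open>-g\<close> on
  \<open>(0, x)\<close>, once the mean is known to be a true preimage under \<open>g\<close>. The
  product form avoids dividing by \<open>cumulative w x\<close> in \<open>ennreal\<close>.\<close>

lemma gen_mean_mult_cumulative_le:
  fixes D :: "real set"
  assumes D: "open D" "is_interval D" and cont: "continuous_on D g" and inj: "inj_on g D"
    and shape: "convex_on D g \<and> antimono_on D g \<or> concave_on D g \<and> mono_on D g"
    and w: "\<And>t. 0 < t \<Longrightarrow> 0 \<le> w t" "set_integrable lebesgue {0<..<x} w" "0 < cumulative w x"
    and f: "f \<in> borel_measurable (lebesgue_on {0<..})" "\<And>t. 0 < t \<Longrightarrow> 0 \<le> f t"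
      "\<And>t. 0 < t \<Longrightarrow> f t \<in> D"
    and wgf: "set_integrable lebesgue {0<..<x} (\<lambda>t. w t * g (f t))"
  shows "ennreal (gen_mean D g w f x * cumulative w x) \<le>
    (\<integral>\<^sup>+t\<in>{0<..<x}. ennreal (w t * f t) \<partial>lebesgue)"
proof -
  let ?M = "lebesgue_on {0<..<x}"
  have int_M: "integrable ?M w" "integrable ?M (\<lambda>t. w t * g (f t))"
    using w(2) wgf by (simp_all add: integrable_restrict_space set_integrable_def)
  have LINT_M: "(LINT t:{0<..<x}|lebesgue. k t) = integral\<^sup>L ?M k" for k :: "real \<Rightarrow> real"
    by (simp add: integral_restrict_space set_lebesgue_integral_def)
  have W: "cumulative w x = integral\<^sup>L ?M w" by (simp add: cumulative_def LINT_M)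
  have f_M: "f \<in> borel_measurable ?M"
    using f(1) by (rule measurable_restrict_mono) auto
  define m where "m = gen_mean D g w f x"
  \<comment> \<open>The continuous image of an interval is an interval, so it contains the average
    of \<open>g \<circ> f\<close>, and there \<open>inv_into\<close> really inverts
    \<open>g\<close>.\<close>
  have "is_interval (g ` D)"
    using connected_continuous_image[OF cont] D(2) by (simp add: is_interval_connected_1)
  then have "integral\<^sup>L ?M (\<lambda>t. w t * g (f t)) / integral\<^sup>L ?M w \<in> g ` D"
    using w int_M f(3) W by (intro weighted_average_in_interval) (auto simp: space_restrict_space)
  moreover have "m = inv_into D g (integral\<^sup>L ?M (\<lambda>t. w t * g (f t)) / integral\<^sup>L ?M w)"
    by (simp add: m_def gen_mean_def LINT_M W)
  ultimately have "m \<in> D" "g m = integral\<^sup>L ?M (\<lambda>t. w t * g (f t)) / integral\<^sup>L ?M w"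
    by (auto simp: inv_into_into f_inv_into_f)
  then have m: "m \<in> D" "g m * integral\<^sup>L ?M w = integral\<^sup>L ?M (\<lambda>t. w t * g (f t))"
    using w(3) W by auto
  have "ennreal (m * integral\<^sup>L ?M w) \<le> (\<integral>\<^sup>+t. ennreal (w t * f t) \<partial>?M)"
    using shape
  proof
    assume "convex_on D g \<and> antimono_on D g"
    then show ?thesis
      using D m inj f f_M w int_M
      by (intro mean_le_nn_integral_of_convex_decreasing[of D m g])
         (auto simp: space_restrict_space)
  next
    \<comment> \<open>The equation for \<open>m\<close> survives a change of sign on both sides, so
      \<open>-g\<close> has the same mean.\<close>
    assume g: "concave_on D g \<and> mono_on D g"
    then have "convex_on D (\<lambda>y. - g y)" "antimono_on D (\<lambda>y. - g y)" "inj_on (\<lambda>y. - g y) D"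
      using inj by (auto simp: concave_on_def monotone_on_def inj_on_def)
    then show ?thesis
      using D m f f_M w int_M
      by (intro mean_le_nn_integral_of_convex_decreasing[of D m "\<lambda>y. - g y"])
         (auto simp: space_restrict_space)
  qed
  then show ?thesis
    by (simp add: nn_integral_restrict_space W m_def)
qed

text \<open>As \<open>w\<close> is nonnegative, its cumulative integral is monotone and hence Borel
  measurable; Borel sets are Lebesgue measurable.\<close>

lemma borel_measurable_cumulative:
  assumes "\<And>x. 0 < x \<Longrightarrow> 0 \<le> w x" "\<And>x. 0 < x \<Longrightarrow> set_integrable lebesgue {0<..<x} w"
  shows "cumulative w \<in> borel_measurable (lebesgue_on {0<..})"
proof -
  have "mono_on {0<..} (cumulative w)"
  proof (rule mono_onI)
    fix x y :: real assume "x \<in> {0<..}" "y \<in> {0<..}" "x \<le> y"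
    then show "cumulative w x \<le> cumulative w y"
      using assms unfolding cumulative_def set_lebesgue_integral_def set_integrable_def
      by (intro integral_mono) (auto simp: indicator_def)
  qed
  then have "cumulative w \<in> borel_measurable (restrict_space borel {0<..})"
    by (rule borel_measurable_mono_on_fnc)
  then show ?thesis
    by (rule borel_measurable_subalgebra[rotated 2])
       (auto simp: sets_restrict_space space_restrict_space)
qed

theorem theorem2p3:
  fixes u w g :: "real \<Rightarrow> real" and v :: "real \<Rightarrow> ennreal" and a b :: ereal
  assumes u: "weight_function u"
    and w_measurable: "w \<in> borel_measurable (lebesgue_on {0<..})"
    and w_nonneg: "\<And>x. 0 < x \<Longrightarrow> 0 \<le> w x"
    and W_finite: "\<And>x. 0 < x \<Longrightarrow> set_integrable lebesgue {0<..<x} w"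
    and W_pos: "\<And>x. 0 < x \<Longrightarrow> 0 < cumulative w x"
    and loc_int: "\<And>t. 0 < t \<Longrightarrow>
      (\<lambda>x. w t * u x / cumulative w x) locally_integrable_on {0<..}"
    and v_def: "\<And>t. 0 < t \<Longrightarrow>
      v t = ennreal (w t) * (\<integral>\<^sup>+x\<in>{t<..}. ennreal (u x / cumulative w x) \<partial>lebesgue)"
    and v_finite: "\<And>t. 0 < t \<Longrightarrow> v t < \<infinity>"
    and ab: "-\<infinity> \<le> a" "a < b" "b \<le> \<infinity>"
    and g_cont: "continuous_on (einterval a b) g"
    and g_strict: "strict_mono_on (einterval a b) g \<or> strict_antimono_on (einterval a b) g"
    and g_shape: "convex_on (einterval a b) g \<and> antimono_on (einterval a b) g \<or>
      concave_on (einterval a b) g \<and> mono_on (einterval a b) g"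
  shows "\<forall>f :: real \<Rightarrow> real.
    f \<in> borel_measurable (lebesgue_on {0<..}) \<and>
    (\<forall>x>0. 0 \<le> f x) \<and>
    (\<forall>x>0. a < ereal (f x) \<and> ereal (f x) < b) \<and>
    gen_mean_defined g w f \<longrightarrow>
      (\<integral>\<^sup>+x\<in>{0<..}. ennreal (u x * gen_mean (einterval a b) g w f x) \<partial>lebesgue)
        \<le> (\<integral>\<^sup>+x\<in>{0<..}. v x * ennreal (f x) \<partial>lebesgue)"
proof (intro allI impI, elim conjE)
  fix f :: "real \<Rightarrow> real"
  assume f_meas: "f \<in> borel_measurable (lebesgue_on {0<..})"
    and f_nonneg: "\<forall>x>0. 0 \<le> f x" and f_dom: "\<forall>x>0. a < ereal (f x) \<and> ereal (f x) < b"
    and mean_def: "gen_mean_defined g w f"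
  let ?D = "einterval a b"
  let ?W = "cumulative w"
  \<comment> \<open>Both factors are extended by zero to the whole line, where the triangle swap is
    stated; the extension turns \<open>{..<x}\<close> into \<open>{0<..<x}\<close>.\<close>
  define A where "A x = ennreal (u x / ?W x) * indicator {0<..} x" for x
  define B where "B t = ennreal (w t * f t) * indicator {0<..} t" for t
  have u_meas: "u \<in> borel_measurable (lebesgue_on {0<..})" and u_pos: "\<And>x. 0 < x \<Longrightarrow> 0 < u x"
    using u by (auto simp: weight_function_def)
  have W_meas: "?W \<in> borel_measurable (lebesgue_on {0<..})"
    using w_nonneg W_finite by (rule borel_measurable_cumulative)
  have A_meas: "A \<in> borel_measurable lebesgue"
    using u_meas W_meas unfolding A_def
    by (subst borel_measurable_restrict_space_iff_ennreal[symmetric]) auto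
  have B_meas: "B \<in> borel_measurable lebesgue"
    using w_measurable f_meas unfolding B_def
    by (subst borel_measurable_restrict_space_iff_ennreal[symmetric]) auto
  have D: "is_interval ?D"
    by (auto simp: is_interval_1 einterval_iff)
       (meson ereal_less_eq(3) le_less_trans less_le_trans)+
  \<comment> \<open>Together with the weak monotonicity in \<open>g_shape\<close>, injectivity gives
    strict monotonicity in the matching direction.\<close>
  have inj: "inj_on g ?D"
    using g_strict by (auto intro: strict_mono_on_imp_inj_on simp: monotone_on_def inj_on_def)
      (metis linorder_neqE_linordered_idom order_less_irrefl)+
  have pointwise: "ennreal (u x * gen_mean ?D g w f x) \<le> A x * (\<integral>\<^sup>+t\<in>{..<x}. B t \<partial>lebesgue)"
    if x: "0 < x" for x
  proof -
    have "ennreal (u x * gen_mean ?D g w f x) =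
        ennreal (u x / ?W x * (gen_mean ?D g w f x * ?W x))"
      using W_pos[OF x] by simp
    \<comment> \<open>The splitting rule asks only that the first factor be nonnegative, so the sign
      of the mean does not have to be determined.\<close>
    also have "\<dots> = ennreal (u x / ?W x) * ennreal (gen_mean ?D g w f x * ?W x)"
      using u_pos[OF x] W_pos[OF x] by (intro ennreal_mult') simp
    also have "\<dots> = A x * ennreal (gen_mean ?D g w f x * ?W x)"
      using x by (simp add: A_def)
    also have "\<dots> \<le> A x * (\<integral>\<^sup>+t\<in>{0<..<x}. ennreal (w t * f t) \<partial>lebesgue)"
      using D g_cont inj g_shape w_nonneg W_finite W_pos f_meas f_nonneg f_dom mean_def x
      by (intro mult_left_mono gen_mean_mult_cumulative_le)
         (auto simp: einterval_iff gen_mean_defined_def)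
    also have "(\<integral>\<^sup>+t\<in>{0<..<x}. ennreal (w t * f t) \<partial>lebesgue) = (\<integral>\<^sup>+t\<in>{..<x}. B t \<partial>lebesgue)"
      by (intro nn_integral_cong) (auto simp: B_def indicator_def)
    finally show ?thesis .
  qed
  have "(\<integral>\<^sup>+x\<in>{0<..}. ennreal (u x * gen_mean ?D g w f x) \<partial>lebesgue)
      \<le> (\<integral>\<^sup>+x. A x * (\<integral>\<^sup>+t\<in>{..<x}. B t \<partial>lebesgue) \<partial>lebesgue)"
    using pointwise by (intro nn_integral_mono) (auto simp: indicator_def)
  also have "\<dots> = (\<integral>\<^sup>+t. B t * (\<integral>\<^sup>+x\<in>{t<..}. A x \<partial>lebesgue) \<partial>lebesgue)"
    using A_meas B_meas by (rule nn_integral_triangle_swap)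
  also have "\<dots> = (\<integral>\<^sup>+t\<in>{0<..}. v t * ennreal (f t) \<partial>lebesgue)"
  proof (rule nn_integral_cong)
    fix t :: real
    show "B t * (\<integral>\<^sup>+x\<in>{t<..}. A x \<partial>lebesgue) = v t * ennreal (f t) * indicator {0<..} t"
    proof (cases "0 < t")
      case True
      \<comment> \<open>For positive \<open>t\<close> the ray \<open>{t<..}\<close> lies in the
        half-line, so the cut-off in \<open>A\<close> disappears; the factor \<open>w t\<close> from
        \<open>B t\<close> then completes the integral to \<open>v t\<close>.\<close>
      then have "(\<integral>\<^sup>+x\<in>{t<..}. A x \<partial>lebesgue) = (\<integral>\<^sup>+x\<in>{t<..}. ennreal (u x / ?W x) \<partial>lebesgue)"
        by (intro nn_integral_cong) (auto simp: A_def indicator_def)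
      with True show ?thesis
        using w_nonneg[OF True] f_nonneg by (simp add: B_def v_def ennreal_mult' mult_ac)
    qed (simp add: B_def)
  qed
  finally show "(\<integral>\<^sup>+x\<in>{0<..}. ennreal (u x * gen_mean ?D g w f x) \<partial>lebesgue)
      \<le> (\<integral>\<^sup>+x\<in>{0<..}. v x * ennreal (f x) \<partial>lebesgue)" .
qed

end
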